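(* Let either $\beta \in [0,\infty)$ and $m = 1$, or $\beta = -1$ and $m \in \mathbb{N}$ with $m > 1$. Let $(T_n)_{n\ge 1}$ be the random tree sequence with parameters $(\beta, m)$ and let $P_n$ be the path length of $T_n$. Then, as $n \to \infty$, $$\mathbf{E}[P_n] = \frac{m}{\beta + m}\, n \log n - \frac{m}{\beta + m}\left(1 + \psi^{(0)}\left(\frac{m}{\beta + m}\right)\right) n + O(\log n),$$ and $$\mathrm{Var}(P_n) = \left(1 + \frac{m}{\beta + m}\left(1 - \frac{m}{\beta + m}\, \psi^{(1)}\left(\frac{m}{\beta + m}\right)\right)\right) n^2 + o(n^2).$$
   Context: Random tree model with parameters $(\beta,m)$: $(T_n)_{n \ge 1}$ is a sequence of random rooted trees, where $T_n$ has $n$ nodes. $T_1$ consists of a single node, the root. For $n \ge 2$, given $T_1,\dots,T_{n-1}$, a node $v \in T_{n-1}$ is chosen with probability proportional to $\beta d_v + m$, where $d_v$ denotes the number of children (outdegree) of $v$ in $T_{n-1}$, and $T_n$ is obtained from $T_{n-1}$ by attaching a new node (the $n$-th inserted node) as a child of $v$. The depth of a node is its graph distance to the root. The path length $P_n$ of $T_n$ is the sum of the depths of all nodes of $T_n$. $\psi^{(0)} = (\log \Gamma)'$ and $\psi^{(1)} = (\log\Gamma)''$ denote the digamma and trigamma functions. *)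

theory Defs
  imports "HOL-Probability.Probability"
begin

text \<open>Nodes are named by the order of insertion: the root is 1 and the \<open>n\<close>-th inserted
  node is \<open>n\<close>.  Edges are directed from parent to child.\<close>

record rooted_tree =
  root :: nat
  nodes :: "nat set"
  edges :: "(nat \<times> nat) set"

definition single_node :: rooted_tree where
  "single_node = \<lparr>root = 1, nodes = {1}, edges = {}\<rparr>"

definition attach :: "rooted_tree \<Rightarrow> nat \<Rightarrow> nat \<Rightarrow> rooted_tree" where
  "attach t v w = t\<lparr>nodes := insert w (nodes t), edges := insert (v, w) (edges t)\<rparr>"

definition outdegree :: "rooted_tree \<Rightarrow> nat \<Rightarrow> nat" where
  "outdegree t v = card {w. (v, w) \<in> edges t}"

definition depth :: "rooted_tree \<Rightarrow> nat \<Rightarrow> nat" where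
  "depth t v = (LEAST k. (root t, v) \<in> (edges t \<union> (edges t)\<inverse>) ^^ k)"

definition path_length :: "rooted_tree \<Rightarrow> nat" where
  "path_length t = (\<Sum>v\<in>nodes t. depth t v)"

definition node_weight :: "real \<Rightarrow> nat \<Rightarrow> rooted_tree \<Rightarrow> nat \<Rightarrow> real" where
  "node_weight \<beta> m t v = \<beta> * real (outdegree t v) + real m"

text \<open>The sequence starts at index 1; \<open>T 0\<close> is unconstrained.  The transition rule is only
  required for histories of positive probability, because \<open>cond_prob\<close> is 0 when conditioning on
  a null event.\<close>

locale random_tree_sequence = prob_space M
  for M :: "'w measure" +
  fixes \<beta> :: real and m :: nat and T :: "nat \<Rightarrow> 'w \<Rightarrow> rooted_tree"
  assumes T_measurable: "\<And>n. n \<ge> 1 \<Longrightarrow> random_variable (count_space UNIV) (T n)"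
    and T_1: "AE \<omega> in M. T 1 \<omega> = single_node"
    and T_step: "\<And>n t v. \<lbrakk>n \<ge> 2; \<P>(\<omega> in M. \<forall>k\<in>{1..n-1}. T k \<omega> = t k) > 0;
        v \<in> nodes (t (n - 1))\<rbrakk> \<Longrightarrow>
      \<P>(\<omega> in M. T n \<omega> = attach (t (n - 1)) v n \<bar> \<forall>k\<in>{1..n-1}. T k \<omega> = t k) =
        node_weight \<beta> m (t (n - 1)) v / (\<Sum>u\<in>nodes (t (n - 1)). node_weight \<beta> m (t (n - 1)) u)"

end

theory Submission
  imports Defs "HOL-Real_Asymp.Real_Asymp"
begin

text \<open>Write \<open>c = m / (\<beta> + m)\<close> and let \<open>P\<close> and \<open>Q\<close> be the sums of the depths and of the squared depths
  in \<open>T\<^sub>n\<close>. Moving the term \<open>\<beta> d\<^sub>v\<close> of the weight of \<open>v\<close> to the children of \<open>v\<close> shows that the total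
  weight is \<open>(\<beta> + m) (n + c - 1)\<close> and that, given \<open>T\<^sub>n\<close>, the depth \<open>X\<close> of the next node has mean
  \<open>(P + c n) / (n + c - 1)\<close> and second moment \<open>(Q + 2 c P + c n) / (n + c - 1)\<close>. So the expectations of
  \<open>P\<close>, \<open>Q\<close> and \<open>P\<^sup>2\<close> satisfy a closed system of linear recurrences. It is solved by observing that,
  without conditioning, \<open>X\<close> has the mean and the variance of a sum of independent Bernoulli variables with parameters
  \<open>c / (c + k)\<close>, \<open>k < n\<close>: the mean of \<open>P\<close> is then a harmonic-type sum, hence a difference of digamma
  values, and the variance divided by \<open>(n + c - 1) (n + c)\<close> has increments \<open>Var X / ((n + c) (n + c + 1))\<close>,
  which sum to \<open>1 + c - c\<^sup>2 \<psi>\<^sup>(\<^sup>1\<^sup>)(c)\<close>.\<close>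

subsection \<open>Depths and weights under attachment of a node\<close>

definition adjacency :: "rooted_tree \<Rightarrow> (nat \<times> nat) set" where
  "adjacency t = edges t \<union> (edges t)\<inverse>"

text \<open>The reachability conjunct guarantees that the \<open>LEAST\<close> in
  \<open>depth\<close> is attained.\<close>

definition well_formed :: "rooted_tree \<Rightarrow> bool" where
  "well_formed t \<longleftrightarrow> finite (nodes t) \<and> root t \<in> nodes t \<and> edges t \<subseteq> nodes t \<times> nodes t \<and>
     (\<forall>v\<in>nodes t. \<exists>k. (root t, v) \<in> adjacency t ^^ k)"

lemma depth_adjacency: "depth t v = (LEAST k. (root t, v) \<in> adjacency t ^^ k)"
  by (simp add: depth_def adjacency_def)

lemma attach_simps [simp]:
  "root (attach t v w) = root t"
  "nodes (attach t v w) = insert w (nodes t)"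
  "edges (attach t v w) = insert (v, w) (edges t)"
  by (simp_all add: attach_def)

lemma adjacency_attach: "adjacency (attach t v w) = adjacency t \<union> {(v, w), (w, v)}"
  by (auto simp: adjacency_def)

lemma adjacency_attach_mono: "adjacency t ^^ k \<subseteq> adjacency (attach t v w) ^^ k"
proof (induction k)
  case (Suc k)
  have "adjacency t \<subseteq> adjacency (attach t v w)" by (auto simp: adjacency_attach)
  with Suc.IH show ?case unfolding relpow.simps by (rule relcomp_mono)
qed simp

text \<open>The only neighbour of the new node \<open>w\<close> is \<open>v\<close>. A walk that
  ends in \<open>w\<close> therefore comes from \<open>v\<close> by its last step, and any other
  walk only gets shorter when its excursions from \<open>v\<close> to \<open>w\<close> and back are
  cut out. This is why depths of old nodes do not change.\<close>

lemma adjacency_attach_relpowD: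
  assumes "well_formed t" "v \<in> nodes t" "w \<notin> nodes t" "(root t, u) \<in> adjacency (attach t v w) ^^ k"
  shows "if u = w then \<exists>j. Suc j \<le> k \<and> (root t, v) \<in> adjacency t ^^ j
         else u \<in> nodes t \<and> (\<exists>j\<le>k. (root t, u) \<in> adjacency t ^^ j)"
  using assms(4)
proof (induction k arbitrary: u)
  case 0
  then show ?case using assms(1,3) by (auto simp: well_formed_def intro!: exI[of _ 0])
next
  case (Suc k)
  from Suc.prems obtain y where y: "(root t, y) \<in> adjacency (attach t v w) ^^ k"
    and yu: "(y, u) \<in> adjacency (attach t v w)"
    by auto
  consider (edge) "(y, u) \<in> adjacency t" | (new) "y = v" "u = w" | (reverse) "y = w" "u = v"
    using yu by (auto simp: adjacency_attach)
  then show ?case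
  proof cases
    case edge
    then have nodes: "y \<in> nodes t" "u \<in> nodes t"
      using assms(1) by (auto simp: adjacency_def well_formed_def)
    then obtain j where "j \<le> k" "(root t, y) \<in> adjacency t ^^ j"
      using Suc.IH[OF y] assms(3) by (auto split: if_splits)
    then have "Suc j \<le> Suc k" "(root t, u) \<in> adjacency t ^^ Suc j"
      using edge by auto
    then show ?thesis using nodes assms(3) by metis
  next
    case new
    then show ?thesis using Suc.IH[OF y] assms(2,3) by (auto split: if_splits)
  next
    \<comment> \<open>The walk returns from \<open>w\<close> to \<open>v\<close>; the induction
      hypothesis for \<open>w\<close> already contains a shorter walk to \<open>v\<close> inside
      \<open>t\<close>.\<close>
    case reverse
    then obtain j where "Suc j \<le> k" "(root t, v) \<in> adjacency t ^^ j"
      using Suc.IH[OF y] by auto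
    then have "j \<le> Suc k" by simp
    then show ?thesis using reverse assms(2,3) \<open>(root t, v) \<in> adjacency t ^^ j\<close> by auto
  qed
qed

lemma depth_reach:
  assumes "well_formed t" "v \<in> nodes t"
  shows "(root t, v) \<in> adjacency t ^^ depth t v"
  using assms LeastI_ex[of "\<lambda>k. (root t, v) \<in> adjacency t ^^ k"]
  by (simp add: well_formed_def depth_adjacency)

lemma depth_le: "(root t, v) \<in> adjacency t ^^ k \<Longrightarrow> depth t v \<le> k"
  by (simp add: depth_adjacency Least_le)

lemma depth_root [simp]: "depth t (root t) = 0"
  using depth_le[of t "root t" 0] by simp

lemma depth_attach_old:
  assumes "well_formed t" "v \<in> nodes t" "w \<notin> nodes t" "u \<in> nodes t"
  shows "depth (attach t v w) u = depth t u"
  unfolding depth_adjacency[of "attach t v w"] attach_simps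
proof (rule Least_equality)
  show "(root t, u) \<in> adjacency (attach t v w) ^^ depth t u"
    using depth_reach[OF assms(1,4)] adjacency_attach_mono by blast
next
  fix k
  assume "(root t, u) \<in> adjacency (attach t v w) ^^ k"
  from adjacency_attach_relpowD[OF assms(1-3) this] show "depth t u \<le> k"
    using assms(3,4) depth_le order_trans by (metis (full_types))
qed

lemma depth_attach_new:
  assumes "well_formed t" "v \<in> nodes t" "w \<notin> nodes t"
  shows "depth (attach t v w) w = Suc (depth t v)"
  unfolding depth_adjacency[of "attach t v w"] attach_simps
proof (rule Least_equality)
  have "(root t, v) \<in> adjacency (attach t v w) ^^ depth t v"
    using depth_reach[OF assms(1,2)] adjacency_attach_mono by blast
  then show "(root t, w) \<in> adjacency (attach t v w) ^^ Suc (depth t v)"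
    by (auto simp: adjacency_attach)
next
  fix k
  assume "(root t, w) \<in> adjacency (attach t v w) ^^ k"
  from adjacency_attach_relpowD[OF assms(1-3) this] show "Suc (depth t v) \<le> k"
    using depth_le by (metis Suc_le_mono order_trans)
qed

lemma well_formed_attach:
  assumes "well_formed t" "v \<in> nodes t" "w \<notin> nodes t"
  shows "well_formed (attach t v w)"
proof -
  have "(root t, u) \<in> adjacency (attach t v w) ^^ depth t u" if "u \<in> nodes t" for u
    using depth_reach[OF assms(1) that] adjacency_attach_mono by blast
  moreover have "(root t, w) \<in> adjacency (attach t v w) ^^ Suc (depth t v)"
    using calculation[OF assms(2)] by (auto simp: adjacency_attach)
  ultimately have "\<forall>u\<in>insert w (nodes t). \<exists>k. (root t, u) \<in> adjacency (attach t v w) ^^ k"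
    by blast
  then show ?thesis using assms by (auto simp: well_formed_def)
qed

lemma finite_children:
  assumes "well_formed t"
  shows "finite {w. (v, w) \<in> edges t}"
proof (rule finite_subset)
  show "{w. (v, w) \<in> edges t} \<subseteq> nodes t" "finite (nodes t)"
    using assms by (auto simp: well_formed_def)
qed

lemma outdegree_attach:
  assumes "well_formed t" "v \<in> nodes t" "w \<notin> nodes t"
  shows "outdegree (attach t v w) u =
    (if u = w then 0 else if u = v then Suc (outdegree t u) else outdegree t u)"
proof -
  have edges: "(x, w) \<notin> edges t" "(w, x) \<notin> edges t" for x
    using assms by (auto simp: well_formed_def)
  have children: "{x. (u, x) \<in> edges (attach t v w)} =
      (if u = v then insert w {x. (u, x) \<in> edges t} else {x. (u, x) \<in> edges t})"
    by auto
  show ?thesis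
    using assms edges finite_children[OF assms(1)] unfolding outdegree_def children by auto
qed

text \<open>No edge of \<open>t\<close> touches \<open>w\<close>, so the single edge into
  \<open>w\<close> reveals the parent. Attachments to different parents thus give disjoint
  events.\<close>

lemma attach_inject:
  assumes "well_formed t" "w \<notin> nodes t" "attach t v w = attach t v' w"
  shows "v = v'"
proof -
  have "insert (v, w) (edges t) = insert (v', w) (edges t)"
    using assms(3) by (metis attach_simps(3))
  moreover have "(v, w) \<notin> edges t" using assms(1,2) by (auto simp: well_formed_def)
  ultimately show ?thesis by blast
qed

text \<open>The parameter \<open>\<psi>\<close> is an arbitrary function of the depth, not a
  polygamma function. The constant 1, the identity and the square give the number of nodes, the path
  length and the sum of squared depths.\<close>

definition depth_sum :: "rooted_tree \<Rightarrow> (nat \<Rightarrow> real) \<Rightarrow> real" where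
  "depth_sum t \<psi> = (\<Sum>v\<in>nodes t. \<psi> (depth t v))"

lemma depth_sum_attach:
  assumes "well_formed t" "v \<in> nodes t" "w \<notin> nodes t"
  shows "depth_sum (attach t v w) \<psi> = depth_sum t \<psi> + \<psi> (Suc (depth t v))"
proof -
  have "finite (nodes t)" using assms(1) by (simp add: well_formed_def)
  moreover have "(\<Sum>u\<in>nodes t. \<psi> (depth (attach t v w) u)) = depth_sum t \<psi>"
    unfolding depth_sum_def by (intro sum.cong) (simp_all add: depth_attach_old assms)
  ultimately show ?thesis
    using assms(3) by (simp add: depth_sum_def depth_attach_new[OF assms])
qed

text \<open>Only two weights matter: \<open>v\<close> gains one child and so the weight \<beta>, and
  \<open>w\<close> enters as a leaf of weight \<open>m\<close>. The old depths persist.\<close>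

lemma weighted_sum_attach:
  assumes "well_formed t" "v \<in> nodes t" "w \<notin> nodes t"
  shows "(\<Sum>u\<in>nodes (attach t v w). node_weight \<beta> m (attach t v w) u * \<phi> (depth (attach t v w) u)) =
    (\<Sum>u\<in>nodes t. node_weight \<beta> m t u * \<phi> (depth t u))
      + \<beta> * \<phi> (depth t v) + real m * \<phi> (Suc (depth t v))"
proof -
  have fin: "finite (nodes t)" using assms(1) by (simp add: well_formed_def)
  have "(\<Sum>u\<in>nodes t. node_weight \<beta> m (attach t v w) u * \<phi> (depth (attach t v w) u)) =
      (\<Sum>u\<in>nodes t. node_weight \<beta> m t u * \<phi> (depth t u) + (if u = v then \<beta> * \<phi> (depth t v) else 0))"
    by (intro sum.cong) (use assms in \<open>auto simp: depth_attach_old node_weight_def outdegree_attach algebra_simps\<close>)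
  also have "\<dots> = (\<Sum>u\<in>nodes t. node_weight \<beta> m t u * \<phi> (depth t u)) + \<beta> * \<phi> (depth t v)"
    using fin assms(2) by (simp add: sum.distrib)
  finally show ?thesis
    using assms(3) fin
    by (simp add: depth_attach_new[OF assms] node_weight_def outdegree_attach[OF assms])
qed

text \<open>The index is shifted: \<open>grown i\<close> consists of trees with \<open>i + 1\<close> nodes. For \<open>\<beta> = -1\<close> it also
  contains trees that occur with probability 0, in which a node has more than \<open>m\<close> children; this is
  harmless because no weight has to be nonnegative.\<close>

primrec grown :: "nat \<Rightarrow> rooted_tree set" where
  "grown 0 = {single_node}"
| "grown (Suc i) = (\<Union>t\<in>grown i. (\<lambda>v. attach t v (Suc (Suc i))) ` nodes t)"

lemma nodes_grown: "t \<in> grown i \<Longrightarrow> nodes t = {1..Suc i}"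
proof (induction i arbitrary: t)
  case 0
  then show ?case by (simp add: single_node_def)
next
  case (Suc i)
  then show ?case by (auto simp: atLeastAtMostSuc_conv)
qed

lemma well_formed_grown: "t \<in> grown i \<Longrightarrow> well_formed t"
proof (induction i arbitrary: t)
  case 0
  then show ?case by (auto simp: single_node_def well_formed_def intro!: exI[of _ 0])
next
  case (Suc i)
  then show ?case by (auto simp: nodes_grown intro!: well_formed_attach)
qed

lemma finite_grown: "finite (grown i)"
  by (induction i) (auto simp: nodes_grown)

lemma grown_attach_hyps:
  assumes "t \<in> grown i"
  shows "well_formed t" "Suc (Suc i) \<notin> nodes t"
  using nodes_grown[OF assms] well_formed_grown[OF assms] by simp_all

text \<open>A node \<open>u\<close> other than the root contributes the summand \<open>\<beta> * \<psi> (depth u)\<close>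
  through the outdegree of its parent, whose depth is \<open>depth u - 1\<close>.\<close>

lemma weighted_sum_grown:
  assumes "t \<in> grown i"
  shows "(\<Sum>u\<in>nodes t. node_weight \<beta> m t u * \<psi> (Suc (depth t u))) =
    \<beta> * (depth_sum t \<psi> - \<psi> 0) + real m * depth_sum t (\<psi> \<circ> Suc)"
  using assms
proof (induction i arbitrary: t)
  case 0
  have "depth single_node 1 = 0"
    using depth_root[of single_node] by (simp add: single_node_def)
  then show ?case
    using 0 by (simp add: single_node_def depth_sum_def node_weight_def outdegree_def)
next
  case (Suc i)
  then obtain s v where s: "s \<in> grown i" "v \<in> nodes s" "t = attach s v (Suc (Suc i))"
    by auto
  note hyps = grown_attach_hyps(1)[OF s(1)] s(2) grown_attach_hyps(2)[OF s(1)]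
  show ?case
    unfolding s(3) weighted_sum_attach[OF hyps, of _ _ "\<lambda>d. \<psi> (Suc d)"] Suc.IH[OF s(1)]
      depth_sum_attach[OF hyps]
    by (simp add: algebra_simps)
qed

lemma depth_sum_one:
  assumes "t \<in> grown i"
  shows "depth_sum t (\<lambda>_. 1) = real (Suc i)"
  using assms by (simp add: depth_sum_def nodes_grown)

lemma path_length_depth_sum: "real (path_length t) = depth_sum t real"
  by (simp add: path_length_def depth_sum_def)

text \<open>The total weight depends on the number of nodes only, so that the recurrences for the
  moments have deterministic coefficients.\<close>

lemma total_weight_grown:
  assumes "t \<in> grown i"
  shows "(\<Sum>u\<in>nodes t. node_weight \<beta> m t u) = \<beta> * real i + real m * real (Suc i)"
  using weighted_sum_grown[OF assms, of \<beta> m "\<lambda>_. 1"] depth_sum_one[OF assms]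
  by (simp add: o_def)

lemma weighted_depth_sum_grown:
  assumes "t \<in> grown i"
  shows "(\<Sum>u\<in>nodes t. node_weight \<beta> m t u * real (Suc (depth t u))) =
    (\<beta> + real m) * depth_sum t real + real m * real (Suc i)"
proof -
  have "depth_sum t (real \<circ> Suc) = depth_sum t real + depth_sum t (\<lambda>_. 1)"
    by (simp add: depth_sum_def sum.distrib)
  then show ?thesis
    using weighted_sum_grown[OF assms, of \<beta> m real] depth_sum_one[OF assms]
    by (simp add: algebra_simps)
qed

lemma weighted_square_depth_sum_grown:
  assumes "t \<in> grown i"
  shows "(\<Sum>u\<in>nodes t. node_weight \<beta> m t u * (real (Suc (depth t u)))\<^sup>2) =
    (\<beta> + real m) * depth_sum t (\<lambda>d. (real d)\<^sup>2) + 2 * real m * depth_sum t real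
      + real m * real (Suc i)"
proof -
  have "depth_sum t ((\<lambda>d. (real d)\<^sup>2) \<circ> Suc) =
      depth_sum t (\<lambda>d. (real d)\<^sup>2) + 2 * depth_sum t real + depth_sum t (\<lambda>_. 1)"
    by (simp add: depth_sum_def sum.distrib sum_distrib_left power2_eq_square algebra_simps)
  then show ?thesis
    using weighted_sum_grown[OF assms, of \<beta> m "\<lambda>d. (real d)\<^sup>2"] depth_sum_one[OF assms]
    by (simp add: algebra_simps)
qed

subsection \<open>Moment recurrences and their asymptotics\<close>

text \<open>Mean depth of the node attached to the tree with \<open>n\<close> nodes, that is, of
  node \<open>n + 1\<close>. The summands are Bernoulli parameters; the first one, for
  \<open>k = 0\<close>, is 1. The variance below has the matching summands
  \<open>p * (1 - p)\<close> with \<open>p = c / (c + k)\<close>.\<close>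

definition insertion_depth_mean :: "real \<Rightarrow> nat \<Rightarrow> real" where
  "insertion_depth_mean c n = (\<Sum>k<n. c / (c + real k))"

definition insertion_depth_variance :: "real \<Rightarrow> nat \<Rightarrow> real" where
  "insertion_depth_variance c n = (\<Sum>k<n. c * real k / (c + real k)\<^sup>2)"

text \<open>Partial sums of the variance increments of the depth, each weighted by
  \<open>\<Sum>j. 1 / ((c + j) * (c + j + 1)) = 1 / (c + k + 1)\<close>, where \<open>j > k\<close>; the limit is the constant in
  the variance of the path length.\<close>

definition scaled_variance_sum :: "real \<Rightarrow> nat \<Rightarrow> real" where
  "scaled_variance_sum c n = (\<Sum>k<n. c * real k / ((c + real k)\<^sup>2 * (c + real k + 1)))"

text \<open>The sequences \<open>e\<close>, \<open>q\<close> and \<open>z\<close> stand for the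
  expectations of P, Q and P^2 in the tree with \<open>i + 1\<close> nodes.\<close>

lemma moment_recurrences_solution:
  fixes c :: real and e q z :: "nat \<Rightarrow> real"
  assumes c: "c > 0" and init: "e 0 = 0" "q 0 = 0" "z 0 = 0"
    and e: "\<And>i. e (Suc i) = e i + (e i + c * real (Suc i)) / (real i + c)"
    and q: "\<And>i. q (Suc i) = q i + (q i + 2 * c * e i + c * real (Suc i)) / (real i + c)"
    and z: "\<And>i. z (Suc i) = z i + (2 * z i + 2 * c * real (Suc i) * e i) / (real i + c)
      + (q i + 2 * c * e i + c * real (Suc i)) / (real i + c)"
  shows "e i = (real i + c) * insertion_depth_mean c (Suc i) - c * real (Suc i)"
    and "z i - (e i)\<^sup>2 = (real i + c) *
      ((real i + 1 + c) * scaled_variance_sum c (Suc i) - insertion_depth_variance c (Suc i))"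
proof -
  define u where "u i = insertion_depth_mean c (Suc i)" for i
  define s where "s i = insertion_depth_variance c (Suc i)" for i
  define G where "G i = scaled_variance_sum c (Suc i)" for i
  \<comment> \<open>The Bernoulli parameter that is added when \<open>i\<close> grows to
    \<open>i + 1\<close>.\<close>
  define p where "p i = c / (real i + 1 + c)" for i :: nat
  have pos: "real i + c > 0" for i using c by (simp add: add_nonneg_pos)
  have u_Suc: "u (Suc i) = u i + p i" for i
    by (simp add: u_def insertion_depth_mean_def p_def add_ac)
  have p: "(real i + 1 + c) * p i = c" for i
    using pos[of i] by (simp add: p_def)
  have r: "c * real (Suc i) / (c + real (Suc i))\<^sup>2 = p i - (p i)\<^sup>2" for i
  proof -
    define y where "y = real i + 1 + c"
    have y: "y \<noteq> 0" "c + real (Suc i) = y" "real (Suc i) = y - c"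
      using pos[of "Suc i"] by (simp_all add: y_def)
    have "c * (y - c) / y\<^sup>2 = c / y - (c / y)\<^sup>2"
      using y(1) by (simp add: field_simps power2_eq_square)
    then show ?thesis unfolding p_def y(2) y(3)[symmetric] by (simp add: y_def)
  qed
  have s_Suc: "s (Suc i) = s i + (p i - (p i)\<^sup>2)" for i
    unfolding r[symmetric] by (simp add: s_def insertion_depth_variance_def)
  have G_Suc: "(real i + 2 + c) * G (Suc i) = (real i + 2 + c) * G i + (p i - (p i)\<^sup>2)" for i
  proof -
    have G: "G (Suc i) = G i + (p i - (p i)\<^sup>2) / (real i + 2 + c)"
      unfolding r[symmetric] by (simp add: G_def scaled_variance_sum_def add_ac)
    show ?thesis unfolding G using pos[of "Suc (Suc i)"] by (simp add: distrib_left)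
  qed
  have u_0: "u 0 = 1" and s_0: "s 0 = 0" and G_0: "G 0 = 0"
    using c by (simp_all add: u_def s_def G_def insertion_depth_mean_def
        insertion_depth_variance_def scaled_variance_sum_def)
  have e_eq: "e i + c * real (Suc i) = (real i + c) * u i" for i
  proof (induction i)
    case (Suc i)
    have "e (Suc i) = e i + u i"
      using e[of i] Suc.IH pos[of i] by simp
    then have "e (Suc i) + c * real (Suc (Suc i)) = (real i + c) * u i + u i + c"
      using Suc.IH by (simp add: algebra_simps)
    also have "\<dots> = (real (Suc i) + c) * u (Suc i)"
      using p[of i] by (simp add: u_Suc algebra_simps)
    finally show ?case .
  qed (simp add: init u_0)
  have e_Suc: "e (Suc i) = e i + u i" for i
    using e[of i] e_eq[of i] pos[of i] by simp
  \<comment> \<open>After division by \<open>real i + c\<close> this says that the second moment of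
    the next depth is its variance \<open>s i\<close> plus its squared mean.\<close>
  have q_eq: "q i + 2 * c * e i + c * real (Suc i) = (real i + c) * (s i + (u i)\<^sup>2)" for i
  proof (induction i)
    case (Suc i)
    have "q (Suc i) = q i + (s i + (u i)\<^sup>2)"
      using q[of i] Suc.IH pos[of i] by simp
    then have "q (Suc i) + 2 * c * e (Suc i) + c * real (Suc (Suc i)) =
        (q i + 2 * c * e i + c * real (Suc i)) + (s i + (u i)\<^sup>2) + c + 2 * c * u i"
      by (simp add: e_Suc algebra_simps)
    also have "\<dots> = (real i + 1 + c) * (s i + (u i)\<^sup>2) + c + 2 * c * u i"
      unfolding Suc.IH by (simp add: algebra_simps)
    \<comment> \<open>Writing \<open>c\<close> as \<open>(real i + 1 + c) * p i\<close> lets the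
      common factor be pulled out; what remains completes the square of
      \<open>u i + p i\<close>.\<close>
    also have "\<dots> = (real i + 1 + c) * (s i + (u i)\<^sup>2)
        + (real i + 1 + c) * p i + 2 * ((real i + 1 + c) * p i) * u i"
      unfolding p ..
    also have "\<dots> = (real (Suc i) + c) * (s (Suc i) + (u (Suc i))\<^sup>2)"
      by (simp add: s_Suc u_Suc algebra_simps power2_eq_square)
    finally show ?case .
  qed (simp add: init u_0 s_0)
  \<comment> \<open>With \<open>x = real i + c\<close>, the variance divided by
    \<open>x * (x + 1)\<close> is the sum over \<open>j < i\<close> of
    \<open>s j / ((j + 1 + c) * (j + 2 + c))\<close>. Exchanging this sum with the one inside
    \<open>s j\<close> and telescoping turns it into \<open>G i - s i / (x + 1)\<close>.\<close>
  have v_eq: "z i - (e i)\<^sup>2 = (real i + c) * ((real i + 1 + c) * G i - s i)" for i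
  proof (induction i)
    case (Suc i)
    define x where "x = real i + c"
    have x: "x > 0" using pos by (simp add: x_def)
    have IH: "z i - (e i)\<^sup>2 = x * ((x + 1) * G i - s i)"
      using Suc.IH by (simp add: x_def add_ac)
    have ce: "c * real (Suc i) = x * u i - e i"
      using e_eq[of i] by (simp add: x_def)
    have "z (Suc i) = z i + (2 * z i + 2 * (x * u i - e i) * e i) / x + (s i + (u i)\<^sup>2)"
      using z[of i] q_eq[of i] x by (simp add: x_def[symmetric] ce[symmetric] mult.assoc)
    also have "\<dots> = z i + 2 * (z i - (e i)\<^sup>2) / x + 2 * u i * e i + (s i + (u i)\<^sup>2)"
      using x by (simp add: field_simps power2_eq_square)
    \<comment> \<open>Subtracting the square of \<open>e i + u i\<close> removes every term in
      \<open>u i\<close>; the variance obeys a linear recurrence with inhomogeneity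
      \<open>s i\<close>.\<close>
    finally have "z (Suc i) - (e (Suc i))\<^sup>2 = (z i - (e i)\<^sup>2) + 2 * ((z i - (e i)\<^sup>2) / x) + s i"
      by (simp add: e_Suc power2_eq_square algebra_simps)
    also have "\<dots> = (x + 2) * ((x + 1) * G i - s i) + s i"
    proof -
      have quotient: "(z i - (e i)\<^sup>2) / x = (x + 1) * G i - s i" using x by (simp add: IH)
      show ?thesis unfolding quotient unfolding IH by (simp add: algebra_simps)
    qed
    also have "\<dots> = (x + 1) * ((x + 2) * G i + (p i - (p i)\<^sup>2) - s (Suc i))"
      by (simp add: s_Suc algebra_simps)
    also have "\<dots> = (x + 1) * ((x + 2) * G (Suc i) - s (Suc i))"
      using G_Suc[of i] by (simp add: x_def add_ac)
    finally show ?case by (simp add: x_def add_ac)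
  qed (simp add: init G_0 s_0)
  show "e i = (real i + c) * insertion_depth_mean c (Suc i) - c * real (Suc i)"
    using e_eq[of i] by (simp add: u_def)
  show "z i - (e i)\<^sup>2 = (real i + c) *
      ((real i + 1 + c) * scaled_variance_sum c (Suc i) - insertion_depth_variance c (Suc i))"
    using v_eq[of i] by (simp add: G_def s_def)
qed

section \<open>Asymptotics of the explicit sums through digamma and trigamma values\<close>

lemma insertion_depth_mean_Digamma:
  assumes "c > 0"
  shows "insertion_depth_mean c n = c * (Digamma (c + real n) - Digamma c)"
proof -
  have "\<forall>k<n. c \<noteq> - of_nat k"
    using assms by (metis add_nonneg_pos of_nat_0_le_iff add.right_inverse less_irrefl add.commute)
  then have "Digamma (c + real n) = Digamma c + (\<Sum>k<n. 1 / (c + real k))"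
    using Polygamma_plus_of_nat[of n c 0] by simp
  then show ?thesis by (simp add: insertion_depth_mean_def sum_distrib_left)
qed

text \<open>By the functional equation, \<open>ln_Gamma\<close> increases by \<open>ln x\<close>
  between \<open>x\<close> and \<open>x + 1\<close>. The mean value theorem makes this a value of
  \<open>Digamma\<close> in between, and monotonicity moves it to the end points.\<close>

lemma Digamma_bounds:
  fixes x :: real
  assumes "x > 0"
  shows "Digamma x \<le> ln x" and "ln x - 1 / x \<le> Digamma x"
proof -
  have "\<exists>y. x < y \<and> y < x + 1 \<and> ln_Gamma (x + 1) - ln_Gamma x = (x + 1 - x) * Digamma y"
    using assms by (intro MVT2) (auto intro!: has_field_derivative_ln_Gamma_real)
  then obtain y where y: "x < y" "y < x + 1" "ln_Gamma (x + 1) - ln_Gamma x = Digamma y"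
    by auto
  have "ln_Gamma (x + 1) = ln x + ln_Gamma x"
    using assms ln_mult_pos[OF assms Gamma_real_pos[OF assms]]
    by (simp add: ln_Gamma_real_pos Gamma_plus1 nonpos_Ints_def)
  then have "Digamma y = ln x" using y by simp
  moreover have "Digamma x \<le> Digamma y" "Digamma y \<le> Digamma (x + 1)"
    using assms y by (auto intro!: Digamma_real_mono)
  moreover have "Digamma (x + 1) = Digamma x + 1 / x"
    using assms by (simp add: Digamma_plus1)
  ultimately show "Digamma x \<le> ln x" "ln x - 1 / x \<le> Digamma x" by auto
qed

text \<open>In the mean of the path length this difference is multiplied by a factor of order
  \<open>n\<close>; the bound keeps the product bounded.\<close>

lemma Digamma_shift_ln:
  fixes c :: real
  assumes "c > 0" "n > 0"
  shows "\<bar>real n * (Digamma (c + real n) - ln (real n))\<bar> \<le> 1 + c"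
proof -
  have n: "real n > 0" using assms by simp
  have "ln (c + real n) - ln (real n) = ln (1 + c / real n)"
    using assms n ln_div[of "c + real n" "real n"] by (simp add: add_divide_distrib add.commute)
  also have "\<dots> \<le> c / real n"
    using assms n by (intro ln_add_one_self_le_self) simp
  finally have "Digamma (c + real n) - ln (real n) \<le> c / real n"
    using Digamma_bounds(1)[of "c + real n"] assms n by simp
  moreover have "ln (real n) \<le> ln (c + real n)" "1 / (c + real n) \<le> 1 / real n"
    using assms n by (auto simp: frac_le)
  then have "- (1 / real n) \<le> Digamma (c + real n) - ln (real n)"
    using Digamma_bounds(2)[of "c + real n"] assms n by linarith
  ultimately have "- 1 \<le> real n * (Digamma (c + real n) - ln (real n))"
    "real n * (Digamma (c + real n) - ln (real n)) \<le> c"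
    using n by (simp_all add: field_simps)
  then show ?thesis using assms by linarith
qed

lemma mean_asymptotics:
  fixes c :: real
  assumes c: "c > 0"
  shows "(\<lambda>n. ((real n - 1 + c) * insertion_depth_mean c n - c * real n)
      - (c * real n * ln (real n) - c * (1 + Digamma c) * real n)) \<in> O(\<lambda>n. ln (real n))"
proof -
  define d where "d n = real n * (Digamma (c + real n) - ln (real n))" for n :: nat
  \<comment> \<open>In the factor \<open>n + (c - 1)\<close>, the part \<open>n\<close> yields the
    main terms and the bounded error \<open>c * d n\<close>. The part \<open>c - 1\<close> meets a
    digamma difference of logarithmic size, the source of the error term.\<close>
  have "((real n - 1 + c) * insertion_depth_mean c n - c * real n)
      - (c * real n * ln (real n) - c * (1 + Digamma c) * real n) =
      c * d n + c * (c - 1) * (d n / real n + ln (real n) - Digamma c)" if "n > 0" for n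
    using that by (simp add: insertion_depth_mean_Digamma[OF c] d_def field_simps)
  then have eq: "\<forall>\<^sub>F n in sequentially. ((real n - 1 + c) * insertion_depth_mean c n - c * real n)
      - (c * real n * ln (real n) - c * (1 + Digamma c) * real n) =
      c * d n + c * (c - 1) * (d n / real n + ln (real n) - Digamma c)"
    by (auto intro: eventually_mono[OF eventually_gt_at_top[of 0]])
  have d: "d \<in> O(\<lambda>_. 1)"
    by (intro bigoI[of _ "1 + c"] eventually_mono[OF eventually_gt_at_top[of 0]])
      (use Digamma_shift_ln[OF c] in \<open>auto simp: d_def\<close>)
  have one: "(\<lambda>n::nat. 1) \<in> O(\<lambda>n. ln (real n))" by real_asymp
  then have d_ln: "d \<in> O(\<lambda>n. ln (real n))" and const: "(\<lambda>n. Digamma c) \<in> O(\<lambda>n. ln (real n))"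
    using landau_o.big_trans[OF d one] landau_o.big_trans[OF bigo_const one] by simp_all
  have "(\<lambda>n. d n * (1 / real n)) \<in> O(\<lambda>n. 1 * ln (real n))"
    by (intro landau_o.big.mult d) real_asymp
  then have "(\<lambda>n. d n / real n) \<in> O(\<lambda>n. ln (real n))" by simp
  \<comment> \<open>The case \<open>a = 0\<close> does occur: \<open>c * (c - 1)\<close> vanishes
    for \<open>c = 1\<close>, that is, for \<beta> = 0.\<close>
  moreover have cmult: "(\<lambda>n. a * f n) \<in> O(\<lambda>n. ln (real n))"
    if "f \<in> O(\<lambda>n. ln (real n))" for a :: real and f
    using that by (cases "a = 0") simp_all
  ultimately have "(\<lambda>n. c * d n + c * (c - 1) * (d n / real n + ln (real n) - Digamma c))
      \<in> O(\<lambda>n. ln (real n))"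
    using d_ln const by (intro sum_in_bigo cmult) auto
  then show ?thesis using landau_o.big.in_cong[OF eq] by blast
qed

text \<open>Partial fractions split each summand into a telescoping difference, which contributes
  \<open>1 + c\<close>, and a term of the trigamma series.\<close>

lemma scaled_variance_sum_tendsto:
  fixes c :: real
  assumes c: "c > 0"
  shows "scaled_variance_sum c \<longlonglongrightarrow> 1 + c * (1 - c * Polygamma 1 c)"
proof -
  have "(\<lambda>k. inverse (c + real k)) \<longlonglongrightarrow> 0" by real_asymp
  from telescope_sums'[OF this]
  have "(\<lambda>k. inverse (c + real k) - inverse (c + real (Suc k))) sums (inverse c)" by simp
  moreover have "(\<lambda>k. inverse ((c + real k)\<^sup>2)) sums Polygamma 1 c"
    using Polygamma_LIMSEQ[of c 1] c by (simp add: numeral_2_eq_2)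
  ultimately have "(\<lambda>k. (c + c\<^sup>2) * (inverse (c + real k) - inverse (c + real (Suc k)))
      - c\<^sup>2 * inverse ((c + real k)\<^sup>2)) sums ((c + c\<^sup>2) * inverse c - c\<^sup>2 * Polygamma 1 c)"
    by (intro sums_diff sums_mult)
  moreover have "(c + c\<^sup>2) * (inverse (c + real k) - inverse (c + real (Suc k)))
      - c\<^sup>2 * inverse ((c + real k)\<^sup>2) = c * real k / ((c + real k)\<^sup>2 * (c + real k + 1))" for k
  proof -
    define y where "y = c + real k"
    have y: "y > 0" using c by (simp add: y_def add_pos_nonneg)
    have k: "real k = y - c" by (simp add: y_def)
    have "(c + c\<^sup>2) * (inverse y - inverse (y + 1)) - c\<^sup>2 * inverse (y\<^sup>2) =
        c * (y - c) / (y\<^sup>2 * (y + 1))"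
      using y by (simp add: divide_simps power2_eq_square) (simp add: algebra_simps)
    then show ?thesis unfolding k[symmetric] by (simp add: y_def add_ac)
  qed
  moreover have "(c + c\<^sup>2) * inverse c - c\<^sup>2 * Polygamma 1 c = 1 + c * (1 - c * Polygamma 1 c)"
    using c by (simp add: field_simps power2_eq_square)
  ultimately show ?thesis by (simp add: sums_def scaled_variance_sum_def[abs_def])
qed

text \<open>Since \<open>p * (1 - p) \<le> p\<close> for each Bernoulli parameter, the variance is
  at most the mean, which grows logarithmically.\<close>

lemma insertion_depth_variance_sublinear:
  fixes c :: real
  assumes c: "c > 0"
  shows "(\<lambda>n. insertion_depth_variance c n / real n) \<longlonglongrightarrow> 0"
proof (rule tendsto_sandwich)
  have pos: "c + real k > 0" for k using c by (simp add: add_pos_nonneg)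
  have "c * real k / (c + real k)\<^sup>2 \<le> c / (c + real k)" for k
    using c pos[of k] divide_right_mono[of "c * real k" "c * (c + real k)" "(c + real k)\<^sup>2"]
    by (simp add: power2_eq_square)
  then have "insertion_depth_variance c n \<le> insertion_depth_mean c n" for n
    unfolding insertion_depth_mean_def insertion_depth_variance_def by (rule sum_mono)
  also have "insertion_depth_mean c n \<le> c * (ln (c + real n) - Digamma c)" for n
    using c pos[of n] Digamma_bounds(1) by (simp add: insertion_depth_mean_Digamma)
  finally have "insertion_depth_variance c n \<le> c * (ln (c + real n) - Digamma c)" for n .
  then show "\<forall>\<^sub>F n in sequentially. insertion_depth_variance c n / real n
      \<le> c * (ln (c + real n) - Digamma c) / real n"
    by (intro always_eventually allI divide_right_mono) auto
  show "\<forall>\<^sub>F n in sequentially. 0 \<le> insertion_depth_variance c n / real n"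
    using c by (auto simp: insertion_depth_variance_def intro!: always_eventually divide_nonneg_nonneg sum_nonneg)
  show "(\<lambda>n. c * (ln (c + real n) - Digamma c) / real n) \<longlonglongrightarrow> 0"
    by real_asymp
qed simp

lemma variance_asymptotics:
  fixes c :: real
  assumes c: "c > 0"
  shows "(\<lambda>n. (real n - 1 + c) *
        ((real n + c) * scaled_variance_sum c n - insertion_depth_variance c n)
      - (1 + c * (1 - c * Polygamma 1 c)) * (real n)\<^sup>2) \<in> o(\<lambda>n. (real n)\<^sup>2)"
    (is "(\<lambda>n. ?v n - ?L * _) \<in> _")
proof (rule smalloI_tendsto)
  have one: "(\<lambda>n. (real n - 1 + c) / real n) \<longlonglongrightarrow> 1" "(\<lambda>n. (real n + c) / real n) \<longlonglongrightarrow> 1"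
    by real_asymp+
  have "(\<lambda>n. (real n - 1 + c) / real n *
      ((real n + c) / real n * scaled_variance_sum c n - insertion_depth_variance c n / real n) - ?L)
      \<longlonglongrightarrow> 1 * (1 * ?L - 0) - ?L"
    by (intro tendsto_intros one scaled_variance_sum_tendsto insertion_depth_variance_sublinear c)
  then have "(\<lambda>n. (real n - 1 + c) / real n *
      ((real n + c) / real n * scaled_variance_sum c n - insertion_depth_variance c n / real n) - ?L)
      \<longlonglongrightarrow> 0" by simp
  then show "(\<lambda>n. (?v n - ?L * (real n)\<^sup>2) / (real n)\<^sup>2) \<longlonglongrightarrow> 0"
  proof (rule Lim_transform_eventually)
    show "\<forall>\<^sub>F n in sequentially. (real n - 1 + c) / real n *
      ((real n + c) / real n * scaled_variance_sum c n - insertion_depth_variance c n / real n) - ?L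
        = (?v n - ?L * (real n)\<^sup>2) / (real n)\<^sup>2"
    proof (rule eventually_mono[OF eventually_gt_at_top[of 0]])
      fix n :: nat assume "n > 0"
      then show "(real n - 1 + c) / real n *
      ((real n + c) / real n * scaled_variance_sum c n - insertion_depth_variance c n / real n) - ?L
        = (?v n - ?L * (real n)\<^sup>2) / (real n)\<^sup>2"
        by (simp add: diff_divide_distrib power2_eq_square right_diff_distrib)
    qed
  qed
qed (auto intro: eventually_mono[OF eventually_gt_at_top[of 0]])

subsection \<open>Expectations over one step of the sequence\<close>

context random_tree_sequence
begin

text \<open>The transition rule conditions on the whole past, so events fix all trees up to index
  \<open>i + 1\<close> and not just the last one.\<close>

definition history_event :: "nat \<Rightarrow> (nat \<Rightarrow> rooted_tree) \<Rightarrow> 'w set" where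
  "history_event i h = {\<omega> \<in> space M. \<forall>k\<in>{1..Suc i}. T k \<omega> = h k}"

definition step_event :: "nat \<Rightarrow> (nat \<Rightarrow> rooted_tree) \<Rightarrow> nat \<Rightarrow> 'w set" where
  "step_event i h v =
    {\<omega> \<in> history_event i h. T (Suc (Suc i)) \<omega> = attach (h (Suc i)) v (Suc (Suc i))}"

text \<open>A finite product of extensional functions, which makes expectations finite sums over
  pasts.\<close>

definition histories :: "nat \<Rightarrow> (nat \<Rightarrow> rooted_tree) set" where
  "histories i = (\<Pi>\<^sub>E k\<in>{1..Suc i}. grown (k - 1))"

lemma sets_T_eq: "k \<ge> 1 \<Longrightarrow> {\<omega> \<in> space M. T k \<omega> = t} \<in> sets M"
  using measurable_sets[OF T_measurable, of k "{t}"] by (simp add: vimage_def Int_def conj_commute)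

lemma sets_history_event [measurable]: "history_event i h \<in> sets M"
  unfolding history_event_def by (intro sets.sets_Collect_finite_All') (auto intro: sets_T_eq)

lemma sets_step_event [measurable]: "step_event i h v \<in> sets M"
proof -
  have "step_event i h v = history_event i h
      \<inter> {\<omega> \<in> space M. T (Suc (Suc i)) \<omega> = attach (h (Suc i)) v (Suc (Suc i))}"
    by (auto simp: step_event_def history_event_def)
  then show ?thesis by (simp add: sets_T_eq sets.Int)
qed

lemma finite_histories: "finite (histories i)"
  unfolding histories_def by (intro finite_PiE) (auto simp: finite_grown)

lemma histories_last: "h \<in> histories i \<Longrightarrow> h (Suc i) \<in> grown i"
  by (auto simp: histories_def dest: PiE_mem[of _ _ _ "Suc i"])

text \<open>Clearing the denominator of the conditional probability extends the transition rule to
  null histories, where both sides are 0.\<close>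

lemma prob_step_event:
  assumes v: "v \<in> nodes (h (Suc i))"
  shows "prob (step_event i h v) = prob (history_event i h) *
    (node_weight \<beta> m (h (Suc i)) v / (\<Sum>u\<in>nodes (h (Suc i)). node_weight \<beta> m (h (Suc i)) u))"
proof (cases "prob (history_event i h) = 0")
  case True
  have "prob (step_event i h v) \<le> prob (history_event i h)"
    by (intro finite_measure_mono) (auto simp: step_event_def)
  then show ?thesis using True by (simp add: measure_le_0_iff)
next
  case False
  then have pos: "prob (history_event i h) > 0" by (simp add: zero_less_measure_iff)
  have step: "step_event i h v = {\<omega> \<in> space M.
      T (Suc (Suc i)) \<omega> = attach (h (Suc i)) v (Suc (Suc i)) \<and> (\<forall>k\<in>{1..Suc i}. T k \<omega> = h k)}"
    by (auto simp: step_event_def history_event_def)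
  have "prob (step_event i h v) / prob (history_event i h) =
      node_weight \<beta> m (h (Suc i)) v / (\<Sum>u\<in>nodes (h (Suc i)). node_weight \<beta> m (h (Suc i)) u)"
    using T_step[of "Suc (Suc i)" h v] pos v
    unfolding cond_prob_def step by (simp add: history_event_def)
  then show ?thesis using False by (simp add: field_simps)
qed

text \<open>The transition rule only prescribes probabilities of attachments. As these events are
  disjoint and their conditional probabilities add up to 1, nothing but attachments can happen, up
  to a null set.\<close>

lemma AE_step_in_history:
  assumes h: "h \<in> histories i" and pos: "\<beta> * real i + real m * real (Suc i) > 0"
  shows "AE \<omega> in M. \<omega> \<in> history_event i h \<longrightarrow> (\<exists>v\<in>nodes (h (Suc i)). \<omega> \<in> step_event i h v)"
proof -
  let ?t = "h (Suc i)"
  note t = histories_last[OF h]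
  have sets: "(\<Union>v\<in>nodes ?t. step_event i h v) \<in> sets M"
    using nodes_grown[OF t] by (intro sets.finite_UN) auto
  have "disjoint_family_on (step_event i h) (nodes ?t)"
    using attach_inject[OF grown_attach_hyps[OF t]]
    by (fastforce simp: disjoint_family_on_def step_event_def)
  then have "prob (\<Union>v\<in>nodes ?t. step_event i h v) = (\<Sum>v\<in>nodes ?t. prob (step_event i h v))"
    using t by (intro finite_measure_finite_Union) (auto simp: nodes_grown)
  also have "\<dots> = prob (history_event i h) *
      ((\<Sum>v\<in>nodes ?t. node_weight \<beta> m ?t v) / (\<Sum>u\<in>nodes ?t. node_weight \<beta> m ?t u))"
    by (simp add: prob_step_event flip: sum_distrib_left sum_divide_distrib)
  also have "\<dots> = prob (history_event i h)"
    using pos by (simp add: total_weight_grown[OF t])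
  finally have "prob (history_event i h - (\<Union>v\<in>nodes ?t. step_event i h v)) = 0"
    using sets by (subst finite_measure_Diff) (auto simp: step_event_def)
  then have "history_event i h - (\<Union>v\<in>nodes ?t. step_event i h v) \<in> null_sets M"
    using sets by (auto simp: null_sets_def emeasure_eq_measure)
  from AE_not_in[OF this] show ?thesis
    by eventually_elim auto
qed

lemma AE_grown:
  assumes pos: "\<And>i. \<beta> * real i + real m * real (Suc i) > 0"
  shows "AE \<omega> in M. \<forall>k\<in>{1..Suc i}. T k \<omega> \<in> grown (k - 1)"
proof (induction i)
  case 0
  then show ?case using T_1 by simp
next
  case (Suc i)
  have "AE \<omega> in M. \<forall>h\<in>histories i.
      \<omega> \<in> history_event i h \<longrightarrow> (\<exists>v\<in>nodes (h (Suc i)). \<omega> \<in> step_event i h v)"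
    using AE_step_in_history[OF _ pos] by (intro AE_finite_allI finite_histories)
  with Suc.IH AE_space show ?case
  proof eventually_elim
    case (elim \<omega>)
    define h where "h = restrict (\<lambda>k. T k \<omega>) {1..Suc i}"
    have h: "h \<in> histories i" using elim(1) by (auto simp: h_def histories_def)
    moreover have "\<omega> \<in> history_event i h" using elim(2) by (auto simp: h_def history_event_def)
    ultimately obtain v where "v \<in> nodes (h (Suc i))" "\<omega> \<in> step_event i h v"
      using elim(3) by blast
    then have "T (Suc (Suc i)) \<omega> \<in> grown (Suc i)"
      using histories_last[OF h] by (auto simp: step_event_def)
    moreover have "{1..Suc (Suc i)} = insert (Suc (Suc i)) {1..Suc i}" by auto
    ultimately show ?case using elim(1) by simp
  qed
qed

lemma measurable_T: "(\<lambda>\<omega>. f (T (Suc i) \<omega>)) \<in> borel_measurable M" for f :: "rooted_tree \<Rightarrow> real"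
  by (rule measurable_compose[OF T_measurable]) simp_all

text \<open>Almost surely the tree takes only finitely many values.\<close>

lemma integrable_T:
  fixes f :: "rooted_tree \<Rightarrow> real"
  assumes pos: "\<And>i. \<beta> * real i + real m * real (Suc i) > 0"
  shows "integrable M (\<lambda>\<omega>. f (T (Suc i) \<omega>))"
proof (rule integrable_const_bound[of _ "\<Sum>t\<in>grown i. \<bar>f t\<bar>"])
  show "AE \<omega> in M. norm (f (T (Suc i) \<omega>)) \<le> (\<Sum>t\<in>grown i. \<bar>f t\<bar>)"
    using AE_grown[OF pos, of i]
  proof eventually_elim
    case (elim \<omega>)
    then have "T (Suc i) \<omega> \<in> grown i" by (auto dest: bspec[of _ _ "Suc i"])
    then show ?case using finite_grown by (auto intro: member_le_sum[of _ _ "\<lambda>t. \<bar>f t\<bar>"])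
  qed
qed (rule measurable_T)

lemma expectation_T_histories:
  fixes g :: "rooted_tree \<Rightarrow> real"
  assumes pos: "\<And>i. \<beta> * real i + real m * real (Suc i) > 0"
  shows "expectation (\<lambda>\<omega>. g (T (Suc i) \<omega>)) =
    (\<Sum>h\<in>histories i. prob (history_event i h) * g (h (Suc i)))"
proof -
  have "AE \<omega> in M. g (T (Suc i) \<omega>) =
      (\<Sum>h\<in>histories i. indicator (history_event i h) \<omega> * g (h (Suc i)))"
    using AE_grown[OF pos, of i] AE_space
  proof eventually_elim
    case (elim \<omega>)
    define h0 where "h0 = restrict (\<lambda>k. T k \<omega>) {1..Suc i}"
    have h0: "h0 \<in> histories i" using elim(1) by (auto simp: h0_def histories_def)
    have unique: "\<omega> \<in> history_event i h \<longleftrightarrow> h = h0" if "h \<in> histories i" for h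
      using that elim(2)
      by (auto simp: h0_def history_event_def histories_def PiE_def intro!: extensionalityI)
    have "(\<Sum>h\<in>histories i. indicator (history_event i h) \<omega> * g (h (Suc i))) =
        (\<Sum>h\<in>histories i. if h = h0 then g (h0 (Suc i)) else 0)"
      by (intro sum.cong) (auto simp: unique)
    then show ?case using h0 finite_histories by (simp add: h0_def)
  qed
  then have "expectation (\<lambda>\<omega>. g (T (Suc i) \<omega>)) =
      expectation (\<lambda>\<omega>. \<Sum>h\<in>histories i. indicator (history_event i h) \<omega> * g (h (Suc i)))"
    by (intro integral_cong_AE measurable_T) measurable
  also have "\<dots> = (\<Sum>h\<in>histories i. prob (history_event i h) * g (h (Suc i)))"
    by (subst Bochner_Integration.integral_sum) (auto simp: emeasure_eq_measure)
  finally show ?thesis .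
qed

text \<open>The tower rule: \<open>g t\<close> is the conditional expectation of \<open>f\<close> at
  the next tree given the present tree \<open>t\<close>. The hypothesis is multiplied by the total
  weight to avoid a quotient.\<close>

lemma expectation_step:
  fixes f g :: "rooted_tree \<Rightarrow> real"
  assumes pos: "\<And>i. \<beta> * real i + real m * real (Suc i) > 0"
    and g: "\<And>t. t \<in> grown i \<Longrightarrow>
      (\<Sum>v\<in>nodes t. node_weight \<beta> m t v * f (attach t v (Suc (Suc i)))) =
      (\<Sum>u\<in>nodes t. node_weight \<beta> m t u) * g t"
  shows "expectation (\<lambda>\<omega>. f (T (Suc (Suc i)) \<omega>)) = expectation (\<lambda>\<omega>. g (T (Suc i) \<omega>))"
proof -
  let ?f = "\<lambda>h v. f (attach (h (Suc i)) v (Suc (Suc i)))"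
  have "AE \<omega> in M. \<forall>h\<in>histories i.
      \<omega> \<in> history_event i h \<longrightarrow> (\<exists>v\<in>nodes (h (Suc i)). \<omega> \<in> step_event i h v)"
    using AE_step_in_history[OF _ pos] by (intro AE_finite_allI finite_histories)
  then have "AE \<omega> in M. f (T (Suc (Suc i)) \<omega>) =
      (\<Sum>h\<in>histories i. \<Sum>v\<in>nodes (h (Suc i)). indicator (step_event i h v) \<omega> * ?f h v)"
    using AE_grown[OF pos, of i] AE_space
  proof eventually_elim
    case (elim \<omega>)
    define h0 where "h0 = restrict (\<lambda>k. T k \<omega>) {1..Suc i}"
    have h0: "h0 \<in> histories i" using elim(2) by (auto simp: h0_def histories_def)
    have unique: "\<omega> \<in> history_event i h \<longleftrightarrow> h = h0" if "h \<in> histories i" for h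
      using that elim(3)
      by (auto simp: h0_def history_event_def histories_def PiE_def intro!: extensionalityI)
    obtain v0 where v0: "v0 \<in> nodes (h0 (Suc i))" "\<omega> \<in> step_event i h0 v0"
      using elim(1) h0 unique by blast
    have unique_node: "\<omega> \<in> step_event i h0 v \<longleftrightarrow> v = v0" for v
      using v0(2) attach_inject[OF grown_attach_hyps[OF histories_last[OF h0]]]
      by (auto simp: step_event_def)
    \<comment> \<open>For a fixed outcome exactly one pair of a history and a parent,
      \<open>h0\<close> and \<open>v0\<close>, contributes.\<close>
    have "(\<Sum>h\<in>histories i. \<Sum>v\<in>nodes (h (Suc i)). indicator (step_event i h v) \<omega> * ?f h v) =
        (\<Sum>h\<in>histories i. if h = h0 then
          \<Sum>v\<in>nodes (h0 (Suc i)). indicator (step_event i h0 v) \<omega> * ?f h0 v else 0)"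
      using unique by (intro sum.cong) (auto simp: step_event_def intro!: sum.neutral)
    also have "\<dots> = (\<Sum>v\<in>nodes (h0 (Suc i)). indicator (step_event i h0 v) \<omega> * ?f h0 v)"
      using h0 finite_histories by simp
    also have "\<dots> = (\<Sum>v\<in>nodes (h0 (Suc i)). if v = v0 then ?f h0 v0 else 0)"
      by (intro sum.cong) (auto simp: unique_node)
    also have "\<dots> = f (T (Suc (Suc i)) \<omega>)"
      using v0 nodes_grown[OF histories_last[OF h0]] by (simp add: step_event_def)
    finally show ?case ..
  qed
  then have "expectation (\<lambda>\<omega>. f (T (Suc (Suc i)) \<omega>)) = expectation (\<lambda>\<omega>. \<Sum>h\<in>histories i.
      \<Sum>v\<in>nodes (h (Suc i)). indicator (step_event i h v) \<omega> * ?f h v)"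
    by (intro integral_cong_AE measurable_T) measurable
  also have "\<dots> = (\<Sum>h\<in>histories i. \<Sum>v\<in>nodes (h (Suc i)). prob (step_event i h v) * ?f h v)"
    by (simp add: Bochner_Integration.integral_sum emeasure_eq_measure)
  also have "\<dots> = (\<Sum>h\<in>histories i. prob (history_event i h) * g (h (Suc i)))"
  proof (rule sum.cong)
    fix h assume h: "h \<in> histories i"
    let ?t = "h (Suc i)"
    let ?W = "\<Sum>u\<in>nodes ?t. node_weight \<beta> m ?t u"
    note t = histories_last[OF h]
    have "?W > 0" using pos by (simp add: total_weight_grown[OF t])
    have "(\<Sum>v\<in>nodes ?t. prob (step_event i h v) * ?f h v) =
        prob (history_event i h) * ((\<Sum>v\<in>nodes ?t. node_weight \<beta> m ?t v * ?f h v) / ?W)"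
      unfolding sum_distrib_left sum_divide_distrib
      by (intro sum.cong) (simp_all add: prob_step_event)
    also have "\<dots> = prob (history_event i h) * g ?t"
      using \<open>?W > 0\<close> by (simp add: g[OF t])
    finally show "(\<Sum>v\<in>nodes ?t. prob (step_event i h v) * ?f h v) =
        prob (history_event i h) * g ?t" .
  qed simp
  also have "\<dots> = expectation (\<lambda>\<omega>. g (T (Suc i) \<omega>))"
    by (simp add: expectation_T_histories[OF pos])
  finally show ?thesis .
qed

lemma expectation_T_1: "expectation (\<lambda>\<omega>. f (T 1 \<omega>)) = f single_node"
  for f :: "rooted_tree \<Rightarrow> real"
proof -
  have "expectation (\<lambda>\<omega>. f (T 1 \<omega>)) = expectation (\<lambda>\<omega>. f single_node)"
    using T_1 measurable_T[of f 0] by (intro integral_cong_AE) auto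
  then show ?thesis by (simp add: prob_space)
qed

end

lemma depth_sum_single_node: "depth_sum single_node \<psi> = \<psi> 0"
  using depth_root[of single_node] by (simp add: depth_sum_def single_node_def)

subsection \<open>Mean and variance of the path length\<close>

theorem mainTheorem3:
  fixes M :: "'w measure" and \<beta> :: real and m :: nat
    and T :: "nat \<Rightarrow> 'w \<Rightarrow> rooted_tree"
  assumes params: "(\<beta> \<ge> 0 \<and> m = 1) \<or> (\<beta> = -1 \<and> m > 1)"
    and T: "random_tree_sequence M \<beta> m T"
  shows "let P = (\<lambda>n \<omega>. real (path_length (T n \<omega>)));
             c = real m / (\<beta> + real m)
         in (\<lambda>n. prob_space.expectation M (P n)
                - (c * real n * ln (real n) - c * (1 + Digamma c) * real n))
              \<in> O(\<lambda>n. ln (real n)) \<and>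
            (\<lambda>n. prob_space.variance M (P n)
                - (1 + c * (1 - c * Polygamma 1 c)) * (real n)\<^sup>2)
              \<in> o(\<lambda>n. (real n)\<^sup>2)"
proof -
  interpret random_tree_sequence M \<beta> m T by (rule T)
  define c where "c = real m / (\<beta> + real m)"
  have \<beta>m: "\<beta> + real m > 0" and m: "real m > 0" using params by auto
  \<comment> \<open>All weighted sums are multiples of \<open>k\<close>, which cancels in the
    transition probabilities; only \<open>c\<close> survives.\<close>
  define k where "k = \<beta> + real m"
  have k: "k > 0" and c: "c > 0" and mk: "real m = k * c"
    using \<beta>m m by (simp_all add: k_def c_def)
  have W: "\<beta> * real i + real m * real (Suc i) = k * (real i + c)" for i
  proof -
    have "\<beta> * real i + real m * real (Suc i) = k * real i + real m"
      by (simp add: k_def algebra_simps)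
    then show ?thesis by (simp add: mk algebra_simps)
  qed
  have N: "real i + c > 0" for i using c by (simp add: add_nonneg_pos)
  have pos: "\<beta> * real i + real m * real (Suc i) > 0" for i
    unfolding W using k N by simp
  note integrable = integrable_T[OF pos]

  define P where "P t = depth_sum t real" for t
  define Q where "Q t = depth_sum t (\<lambda>d. (real d)\<^sup>2)" for t
  \<comment> \<open>Divided by \<open>real i + c\<close>, \<open>S i t\<close> and
    \<open>R i t\<close> are the conditional first and second moments of the depth of the next
    node.\<close>
  define S where "S i t = P t + c * real (Suc i)" for i t
  define R where "R i t = Q t + 2 * c * P t + c * real (Suc i)" for i t
  have total: "(\<Sum>v\<in>nodes t. node_weight \<beta> m t v) = k * (real i + c)"
    if "t \<in> grown i" for i t
    using total_weight_grown[OF that] W by simp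
  have first: "(\<Sum>v\<in>nodes t. node_weight \<beta> m t v * real (Suc (depth t v))) = k * S i t"
    if "t \<in> grown i" for i t
    unfolding weighted_depth_sum_grown[OF that] S_def P_def k_def[symmetric] unfolding mk by (simp add: algebra_simps)
  have second: "(\<Sum>v\<in>nodes t. node_weight \<beta> m t v * (real (Suc (depth t v)))\<^sup>2) =
      k * R i t" if "t \<in> grown i" for i t
    unfolding weighted_square_depth_sum_grown[OF that] R_def P_def Q_def k_def[symmetric] unfolding mk
    by (simp add: algebra_simps)
  note attach = depth_sum_attach[OF grown_attach_hyps(1) _ grown_attach_hyps(2)]

  define e where "e i = expectation (\<lambda>\<omega>. P (T (Suc i) \<omega>))" for i
  define q where "q i = expectation (\<lambda>\<omega>. Q (T (Suc i) \<omega>))" for i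
  define z where "z i = expectation (\<lambda>\<omega>. (P (T (Suc i) \<omega>))\<^sup>2)" for i
  have "e 0 = 0" "q 0 = 0" "z 0 = 0"
    using expectation_T_1[of P] expectation_T_1[of Q] expectation_T_1[of "\<lambda>t. (P t)\<^sup>2"]
    by (simp_all add: e_def q_def z_def P_def Q_def depth_sum_single_node)
  moreover have "e (Suc i) = e i + (e i + c * real (Suc i)) / (real i + c)" for i
  proof -
    have "e (Suc i) = expectation (\<lambda>\<omega>. P (T (Suc i) \<omega>) + S i (T (Suc i) \<omega>) / (real i + c))"
      unfolding e_def
    proof (rule expectation_step[OF pos])
      fix t assume t: "t \<in> grown i"
      have "(\<Sum>v\<in>nodes t. node_weight \<beta> m t v * P (attach t v (Suc (Suc i)))) =
          (\<Sum>v\<in>nodes t. node_weight \<beta> m t v) * P t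
            + (\<Sum>v\<in>nodes t. node_weight \<beta> m t v * real (Suc (depth t v)))"
        unfolding sum_distrib_right sum.distrib[symmetric]
        by (intro sum.cong) (simp_all add: P_def attach[OF t _ t] algebra_simps)
      also have "\<dots> = (\<Sum>v\<in>nodes t. node_weight \<beta> m t v) * (P t + S i t / (real i + c))"
        unfolding first[OF t] total[OF t] using N[of i] by (simp add: field_simps)
      finally show "(\<Sum>v\<in>nodes t. node_weight \<beta> m t v * P (attach t v (Suc (Suc i)))) =
          (\<Sum>v\<in>nodes t. node_weight \<beta> m t v) * (P t + S i t / (real i + c))" .
    qed
    then show ?thesis
      by (simp add: S_def integrable e_def prob_space)
  qed
  moreover have "q (Suc i) = q i + (q i + 2 * c * e i + c * real (Suc i)) / (real i + c)" for i
  proof -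
    have "q (Suc i) = expectation (\<lambda>\<omega>. Q (T (Suc i) \<omega>) + R i (T (Suc i) \<omega>) / (real i + c))"
      unfolding q_def
    proof (rule expectation_step[OF pos])
      fix t assume t: "t \<in> grown i"
      have "(\<Sum>v\<in>nodes t. node_weight \<beta> m t v * Q (attach t v (Suc (Suc i)))) =
          (\<Sum>v\<in>nodes t. node_weight \<beta> m t v) * Q t
            + (\<Sum>v\<in>nodes t. node_weight \<beta> m t v * (real (Suc (depth t v)))\<^sup>2)"
        unfolding sum_distrib_right sum.distrib[symmetric]
        by (intro sum.cong) (simp_all add: Q_def attach[OF t _ t] algebra_simps)
      also have "\<dots> = (\<Sum>v\<in>nodes t. node_weight \<beta> m t v) * (Q t + R i t / (real i + c))"
        unfolding second[OF t] total[OF t] using N[of i] by (simp add: field_simps)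
      finally show "(\<Sum>v\<in>nodes t. node_weight \<beta> m t v * Q (attach t v (Suc (Suc i)))) =
          (\<Sum>v\<in>nodes t. node_weight \<beta> m t v) * (Q t + R i t / (real i + c))" .
    qed
    then show ?thesis
      by (simp add: R_def integrable e_def q_def prob_space)
  qed
  moreover have "z (Suc i) = z i + (2 * z i + 2 * c * real (Suc i) * e i) / (real i + c)
      + (q i + 2 * c * e i + c * real (Suc i)) / (real i + c)" for i
  proof -
    have scale: "k * x * (a + b / x + d / x) = k * x * a + k * b + k * d" if "x > 0" for x a b d :: real
      using that by (simp add: distrib_left)
    have "z (Suc i) = expectation (\<lambda>\<omega>. (P (T (Suc i) \<omega>))\<^sup>2
        + (2 * P (T (Suc i) \<omega>) * S i (T (Suc i) \<omega>)) / (real i + c) + R i (T (Suc i) \<omega>) / (real i + c))"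
      unfolding z_def
    proof (rule expectation_step[OF pos])
      fix t assume t: "t \<in> grown i"
      let ?rhs = "(P t)\<^sup>2 + (2 * P t * S i t) / (real i + c) + R i t / (real i + c)"
      \<comment> \<open>Expansion of \<open>(P + X)^2\<close>, where \<open>X\<close> is the depth
        of the new node.\<close>
      have "(\<Sum>v\<in>nodes t. node_weight \<beta> m t v * (P (attach t v (Suc (Suc i))))\<^sup>2) =
          (\<Sum>v\<in>nodes t. node_weight \<beta> m t v) * (P t)\<^sup>2
            + 2 * P t * (\<Sum>v\<in>nodes t. node_weight \<beta> m t v * real (Suc (depth t v)))
            + (\<Sum>v\<in>nodes t. node_weight \<beta> m t v * (real (Suc (depth t v)))\<^sup>2)"
        unfolding sum_distrib_right sum_distrib_left sum.distrib[symmetric]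
        by (intro sum.cong) (simp_all add: P_def attach[OF t _ t] algebra_simps power2_eq_square)
      also have "\<dots> = (\<Sum>v\<in>nodes t. node_weight \<beta> m t v) * ?rhs"
        unfolding first[OF t] second[OF t] total[OF t] scale[OF N] by simp
      finally show "(\<Sum>v\<in>nodes t. node_weight \<beta> m t v * (P (attach t v (Suc (Suc i))))\<^sup>2) =
          (\<Sum>v\<in>nodes t. node_weight \<beta> m t v) * ?rhs" .
    qed
    \<comment> \<open>The product of \<open>P\<close> and \<open>S i\<close> is expanded so that
      only P^2, P and Q occur, which closes the system of recurrences.\<close>
    also have "(\<lambda>\<omega>. (P (T (Suc i) \<omega>))\<^sup>2
        + (2 * P (T (Suc i) \<omega>) * S i (T (Suc i) \<omega>)) / (real i + c) + R i (T (Suc i) \<omega>) / (real i + c)) =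
      (\<lambda>\<omega>. (P (T (Suc i) \<omega>))\<^sup>2
        + (2 * (P (T (Suc i) \<omega>))\<^sup>2 + 2 * c * real (Suc i) * P (T (Suc i) \<omega>)) / (real i + c)
        + (Q (T (Suc i) \<omega>) + 2 * c * P (T (Suc i) \<omega>) + c * real (Suc i)) / (real i + c))"
      by (simp add: S_def R_def power2_eq_square algebra_simps)
    also have "expectation \<dots> = z i + (2 * z i + 2 * c * real (Suc i) * e i) / (real i + c)
      + (q i + 2 * c * e i + c * real (Suc i)) / (real i + c)"
      using integrable[of "\<lambda>t. (P t)\<^sup>2"]
      by (simp add: integrable e_def q_def z_def prob_space)
    finally show ?thesis .
  qed
  ultimately have mean: "e i = (real i + c) * insertion_depth_mean c (Suc i) - c * real (Suc i)"
    and var: "z i - (e i)\<^sup>2 = (real i + c) *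
      ((real i + 1 + c) * scaled_variance_sum c (Suc i) - insertion_depth_variance c (Suc i))" for i
    using moment_recurrences_solution[OF c, of e q z i] by blast+

  \<comment> \<open>The tree with index 0 is unconstrained, so the closed forms are claimed for
    \<open>n > 0\<close> only; the index shift \<open>n = Suc i\<close> is undone here.\<close>
  have expectation: "\<forall>\<^sub>F n in sequentially. expectation (\<lambda>\<omega>. real (path_length (T n \<omega>))) =
      (real n - 1 + c) * insertion_depth_mean c n - c * real n"
  proof (rule eventually_mono[OF eventually_gt_at_top[of 0]])
    fix n :: nat assume "n > 0"
    then obtain i where "n = Suc i" by (cases n) auto
    then show "expectation (\<lambda>\<omega>. real (path_length (T n \<omega>))) =
        (real n - 1 + c) * insertion_depth_mean c n - c * real n"
      using mean[of i] by (simp add: e_def P_def path_length_depth_sum)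
  qed
  have variance: "\<forall>\<^sub>F n in sequentially. variance (\<lambda>\<omega>. real (path_length (T n \<omega>))) =
      (real n - 1 + c) * ((real n + c) * scaled_variance_sum c n - insertion_depth_variance c n)"
  proof (rule eventually_mono[OF eventually_gt_at_top[of 0]])
    fix n :: nat assume "n > 0"
    then obtain i where n: "n = Suc i" by (cases n) auto
    have "variance (\<lambda>\<omega>. P (T n \<omega>)) = z i - (e i)\<^sup>2"
      unfolding n e_def z_def
      by (rule variance_eq) (use integrable[of P] integrable[of "\<lambda>t. (P t)\<^sup>2"] in auto)
    then show "variance (\<lambda>\<omega>. real (path_length (T n \<omega>))) =
        (real n - 1 + c) * ((real n + c) * scaled_variance_sum c n - insertion_depth_variance c n)"
      using var[of i] by (simp add: n P_def path_length_depth_sum add_ac)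
  qed
  show ?thesis
    unfolding Let_def c_def[symmetric]
  proof
    show "(\<lambda>n. expectation (\<lambda>\<omega>. real (path_length (T n \<omega>)))
        - (c * real n * ln (real n) - c * (1 + Digamma c) * real n)) \<in> O(\<lambda>n. ln (real n))"
      by (rule landau_o.big.in_cong[THEN iffD2, OF _ mean_asymptotics[OF c]])
        (use expectation in eventually_elim, simp)
    show "(\<lambda>n. variance (\<lambda>\<omega>. real (path_length (T n \<omega>)))
        - (1 + c * (1 - c * Polygamma 1 c)) * (real n)\<^sup>2) \<in> o(\<lambda>n. (real n)\<^sup>2)"
      by (rule landau_o.small.in_cong[THEN iffD2, OF _ variance_asymptotics[OF c]])
        (use variance in eventually_elim, simp)
  qed
qed

end
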